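(* For every rational number $t\in[1,5/2)$ there is a finite family $\mathcal R$ of axis-parallel rectangles with $\alpha^*(\mathcal R)/\nu(\mathcal R)=t$. Likewise, for every rational number $t\in[1,5/2)$ there is a finite family $\mathcal R$ of axis-parallel rectangles with $\tau(\mathcal R)/\nu(\mathcal R)=t$.
   Context: All rectangles are closed and lie in the plane. For a finite family $\mathcal R$ of rectangles, $\nu(\mathcal R)$ is the maximum size of a pairwise disjoint subfamily, $\tau(\mathcal R)$ is the minimum number of points of the plane such that every rectangle of $\mathcal R$ contains at least one of them, and $G(\mathcal R)$ is the intersection graph (vertices are the rectangles, edges join intersecting pairs). The clique relaxation value is $$\alpha^*(\mathcal R)=\max\Big\{\sum_{v}x_v:\ x_v\ge 0,\ \sum_{v\in K}x_v\le 1\text{ for every clique }K\text{ of }G(\mathcal R)\Big\}.$$ The ratios refer to nonempty families. *)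

theory Defs
  imports "HOL-Analysis.Analysis"
begin

definition axis_rectangle :: "(real \<times> real) set \<Rightarrow> bool" where
  "axis_rectangle A \<longleftrightarrow> (\<exists>a b c d. a < b \<and> c < d \<and> A = {a..b} \<times> {c..d})"

(* A graph is given by its vertex set and its set of (two-element) edges. *)

definition intersection_edges :: "'p set set \<Rightarrow> 'p set set set" where
  "intersection_edges R = {{A, B} | A B. A \<in> R \<and> B \<in> R \<and> A \<noteq> B \<and> A \<inter> B \<noteq> {}}"

definition cliques :: "'v set \<Rightarrow> 'v set set \<Rightarrow> 'v set set" where
  "cliques V E = {K. K \<subseteq> V \<and> (\<forall>u\<in>K. \<forall>v\<in>K. u \<noteq> v \<longrightarrow> {u, v} \<in> E)}"

definition clique_feasible :: "'v set \<Rightarrow> 'v set set \<Rightarrow> ('v \<Rightarrow> real) \<Rightarrow> bool" where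
  "clique_feasible V E x \<longleftrightarrow>
     (\<forall>v\<in>V. 0 \<le> x v) \<and> (\<forall>K\<in>cliques V E. (\<Sum>v\<in>K. x v) \<le> 1)"

(* For finite V the supremum is a maximum: see clique_relaxation_attained below. *)
definition clique_relaxation :: "'v set \<Rightarrow> 'v set set \<Rightarrow> real" where
  "clique_relaxation V E = Sup {(\<Sum>v\<in>V. x v) | x. clique_feasible V E x}"

definition alpha_star :: "'p set set \<Rightarrow> real" where
  "alpha_star R = clique_relaxation R (intersection_edges R)"

definition packing_number :: "'p set set \<Rightarrow> nat" where
  "packing_number R = Max {card S | S. S \<subseteq> R \<and> pairwise disjnt S}"

definition piercing_number :: "'p set set \<Rightarrow> nat" where
  "piercing_number R = (LEAST k. \<exists>P. finite P \<and> card P = k \<and> (\<forall>A\<in>R. A \<inter> P \<noteq> {}))"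

lemma clique_relaxation_attained:
  assumes "finite V"
  shows "\<exists>x. clique_feasible V E x \<and> (\<Sum>v\<in>V. x v) = clique_relaxation V E"
    and "clique_feasible V E y \<Longrightarrow> (\<Sum>v\<in>V. y v) \<le> clique_relaxation V E"
proof -
  define C :: "('a \<Rightarrow> real) set" where "C = PiE UNIV (\<lambda>v. if v \<in> V then {0..1} else {0})"
  define F where "F = C \<inter> (\<Inter>K\<in>cliques V E. {x. (\<Sum>v\<in>K. x v) \<le> 1})"
  have "compactin (product_topology (\<lambda>_. euclidean) UNIV) C"
    unfolding C_def by (subst compactin_PiE) auto
  then have "compact C"
    by (simp add: euclidean_product_topology)
  moreover have "closed {x :: 'a \<Rightarrow> real. (\<Sum>v\<in>K. x v) \<le> 1}" for K
    by (intro closed_Collect_le continuous_on_sum continuous_on_product_coordinates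
          continuous_on_const)
  ultimately have cF: "compact F"
    unfolding F_def by (intro compact_Int_closed closed_INT ballI) auto
  have sub: "K \<subseteq> V" if "K \<in> cliques V E" for K
    using that by (auto simp: cliques_def)
  have "(\<lambda>_. 0) \<in> F"
    by (auto simp: F_def C_def)
  then have ne: "F \<noteq> {}" by blast
  have Ffeas: "clique_feasible V E x" if x: "x \<in> F" for x
  proof -
    have "0 \<le> x v" if "v \<in> V" for v
      using x that by (auto simp: F_def C_def PiE_def Pi_def split: if_splits dest: spec[of _ v])
    then show ?thesis
      using x by (auto simp: F_def clique_feasible_def)
  qed
  have feasF: "\<exists>x\<in>F. (\<Sum>v\<in>V. x v) = (\<Sum>v\<in>V. z v)" if z: "clique_feasible V E z" for z
  proof -
    define x where "x v = (if v \<in> V then z v else 0)" for v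
    have "z v \<le> 1" if "v \<in> V" for v
    proof -
      have "{v} \<in> cliques V E" using that by (auto simp: cliques_def)
      then have "(\<Sum>u\<in>{v}. z u) \<le> 1" using z unfolding clique_feasible_def by blast
      then show ?thesis by simp
    qed
    then have "x \<in> C"
      using z by (auto simp: C_def x_def clique_feasible_def)
    moreover have "(\<Sum>v\<in>K. x v) = (\<Sum>v\<in>K. z v)" if "K \<subseteq> V" for K
      using that by (intro sum.cong) (auto simp: x_def)
    ultimately show ?thesis
      using z sub by (intro bexI[of _ x]) (auto simp: F_def clique_feasible_def)
  qed
  have "continuous_on F (\<lambda>x. \<Sum>v\<in>V. x v)"
    by (intro continuous_on_sum continuous_on_subset[OF continuous_on_product_coordinates]) auto
  from continuous_attains_sup[OF cF ne this]
  obtain m where m: "m \<in> F" "\<And>x. x \<in> F \<Longrightarrow> (\<Sum>v\<in>V. x v) \<le> (\<Sum>v\<in>V. m v)"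
    by blast
  have ub: "(\<Sum>v\<in>V. z v) \<le> (\<Sum>v\<in>V. m v)" if "clique_feasible V E z" for z
    using feasF[OF that] m(2) by force
  have eq: "clique_relaxation V E = (\<Sum>v\<in>V. m v)"
    unfolding clique_relaxation_def
    using Ffeas[OF m(1)] ub by (intro cSup_eq_maximum) auto
  show "\<exists>x. clique_feasible V E x \<and> (\<Sum>v\<in>V. x v) = clique_relaxation V E"
    using Ffeas[OF m(1)] eq by auto
  show "(\<Sum>v\<in>V. y v) \<le> clique_relaxation V E" if "clique_feasible V E y"
    using ub[OF that] eq by simp
qed

end

theory Submission
  imports Defs
begin

text \<open>
  Both ratios are read off from families without three pairwise intersecting rectangles that are
  pierced by half as many points as they have members. Giving every rectangle weight \<open>1 / 2\<close> is then
  a feasible fractional packing, and weak duality with the piercing points forces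
  \<open>\<alpha>* = \<tau> = |R| / 2\<close> (\<open>half_integral_family_values\<close>), so only the packing number remains to be controlled.

  The extremal families have \<open>20n\<close> rectangles and packing number at most \<open>4n + 8\<close>, which gives
  ratios tending to \<open>5 / 2\<close>. For each \<open>i < n\<close> there are four \<^emph>\<open>bands\<close>: two horizontal ones, at heights
  close to \<open>5i + 5\<close> and \<open>-(5i + 5)\<close>, and their two reflections in the diagonal. A band holds five bars whose
  intersection graph is a 5-cycle: on each side of the origin an outer bar reaching from \<open>5i + 5\<close> to the
  rim and an inner bar reaching back to the axis, where the two inner bars touch, and a
  bridge running from one outer bar to the other. An independent set of the
  5-cycle has size at most the number of sides (left, right) on which it has a bar, the bridge
  counting for both (\<open>card_parts_le_sides\<close>).

  A side of a horizontal band and a side of a vertical band live in a common quadrant. In the quadrant,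
  the outer bars of both kinds with the same index meet at the corner \<open>(5i + 5, 5i + 5)\<close>, and every inner bar
  or bridge of one kind meets those of the other kind just inside that corner. The only disjoint pairs of
  index \<open>i\<close> consist of an outer bar and an inner bar or bridge of the other kind; but an
  outer bar crosses all inner bars and bridges of the other kind with a larger index, so among
  disjoint bars such a pair occurs for at most one index per quadrant and kind. Hence in
  each quadrant the disjoint bars occupy at most \<open>n + 2\<close> sides, and altogether there
  are at most \<open>4 (n + 2)\<close> of them (\<open>card_disjoint_bars\<close>).

  Three pairwise intersecting bars are impossible: within a band because a 5-cycle has no triangle, and
  otherwise because two of them touch within a band, and the place of contact is never met by a bar of
  the other kind (\<open>crossing_misses_contact\<close>).

  Far apart translates add up all parameters. Several copies of a family with ratio above \<open>t\<close> together with the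
  right number of intersecting pairs, each of which contributes 1 to all parameters, give any rational
  \<open>t\<close> in the range exactly.
\<close>

section \<open>Triangle-free families with a perfect matching\<close>

definition triangle_free :: "'p set set \<Rightarrow> bool" where
  "triangle_free R \<longleftrightarrow>
     (\<forall>A\<in>R. \<forall>B\<in>R. \<forall>C\<in>R. A \<noteq> B \<and> B \<noteq> C \<and> A \<noteq> C \<longrightarrow> A \<inter> B = {} \<or> B \<inter> C = {} \<or> A \<inter> C = {})"

text \<open>
  A triangle-free family with \<open>2a\<close> members needs at least \<open>a\<close> piercing points, so the point set
  required here is optimal: it amounts to a perfect matching of the intersection graph. The
  packing number is a parameter of the predicate because it adds up together with \<open>a\<close>.
\<close>

definition half_integral_family :: "(real \<times> real) set set \<Rightarrow> nat \<Rightarrow> nat \<Rightarrow> bool" where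
  "half_integral_family R a b \<longleftrightarrow>
     finite R \<and> (\<forall>A\<in>R. axis_rectangle A) \<and> triangle_free R \<and> card R = 2 * a \<and>
     (\<exists>P. finite P \<and> card P \<le> a \<and> (\<forall>A\<in>R. A \<inter> P \<noteq> {})) \<and> packing_number R = b"

text \<open>
  Weak duality: the members through a common point form a clique, so each point pays for weight at most 1.
\<close>

lemma fractional_packing_le_piercing:
  assumes R: "finite R" and x: "clique_feasible R (intersection_edges R) x"
    and P: "finite P" "\<forall>A\<in>R. A \<inter> P \<noteq> {}"
  shows "(\<Sum>A\<in>R. x A) \<le> real (card P)"
proof -
  have nonneg: "0 \<le> x A" if "A \<in> R" for A
    using x that by (simp add: clique_feasible_def)
  have star: "(\<Sum>A\<in>{A\<in>R. p \<in> A}. x A) \<le> 1" for p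
  proof -
    have "{A\<in>R. p \<in> A} \<in> cliques R (intersection_edges R)"
      by (auto simp: cliques_def intersection_edges_def)
    then show ?thesis using x by (simp add: clique_feasible_def)
  qed
  have "(\<Sum>A\<in>R. x A) \<le> (\<Sum>A\<in>R. \<Sum>p\<in>P. if p \<in> A then x A else 0)"
  proof (rule sum_mono)
    fix A assume A: "A \<in> R"
    then obtain p where p: "p \<in> A" "p \<in> P" using P by blast
    have "x A = (\<Sum>q\<in>{p}. if q \<in> A then x A else 0)" using p by simp
    also have "\<dots> \<le> (\<Sum>q\<in>P. if q \<in> A then x A else 0)"
      using p P nonneg[OF A] by (intro sum_mono2) auto
    finally show "x A \<le> (\<Sum>q\<in>P. if q \<in> A then x A else 0)" .
  qed
  also have "\<dots> = (\<Sum>p\<in>P. \<Sum>A\<in>R. if p \<in> A then x A else 0)"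
    by (rule sum.swap)
  also have "\<dots> = (\<Sum>p\<in>P. \<Sum>A\<in>{A\<in>R. p \<in> A}. x A)"
    using R by (simp add: sum.inter_filter)
  also have "\<dots> \<le> (\<Sum>p\<in>P. 1)"
    by (intro sum_mono star)
  finally show ?thesis by simp
qed

lemma triangle_free_half_feasible:
  assumes "triangle_free R"
  shows "clique_feasible R (intersection_edges R) (\<lambda>_. 1 / 2)"
  unfolding clique_feasible_def
proof (intro conjI ballI)
  fix K assume K: "K \<in> cliques R (intersection_edges R)"
  have meet: "A \<inter> B \<noteq> {}" if "A \<in> K" "B \<in> K" "A \<noteq> B" for A B
  proof -
    have "{A, B} \<in> intersection_edges R" using K that by (auto simp: cliques_def)
    then show ?thesis by (auto simp: intersection_edges_def doubleton_eq_iff)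
  qed
  have "card K \<le> 2"
  proof (rule ccontr)
    assume "\<not> card K \<le> 2"
    then obtain T where "T \<subseteq> K" "card T = 3"
      by (metis Suc_leI eval_nat_numeral(3) not_le obtain_subset_with_card_n)
    then obtain A B C where "{A, B, C} \<subseteq> K" "A \<noteq> B" "B \<noteq> C" "A \<noteq> C"
      by (auto simp: card_3_iff)
    then have ABC: "A \<in> K" "B \<in> K" "C \<in> K" "A \<noteq> B" "B \<noteq> C" "A \<noteq> C" by auto
    then have "A \<in> R" "B \<in> R" "C \<in> R" using K by (auto simp: cliques_def)
    then have "A \<inter> B = {} \<or> B \<inter> C = {} \<or> A \<inter> C = {}"
      using assms ABC(4-6) unfolding triangle_free_def by metis
    then show False using meet ABC by metis
  qed
  then show "(\<Sum>A\<in>K. 1 / 2 :: real) \<le> 1" by simp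
qed simp

lemma half_integral_family_values:
  assumes "half_integral_family R a b"
  shows "alpha_star R = real a" "piercing_number R = a"
proof -
  let ?E = "intersection_edges R"
  obtain P where R: "finite R" "triangle_free R" "card R = 2 * a"
    and P: "finite P" "card P \<le> a" "\<forall>A\<in>R. A \<inter> P \<noteq> {}"
    using assms by (auto simp: half_integral_family_def)
  have half: "clique_feasible R ?E (\<lambda>_. 1 / 2)"
    using R(2) by (rule triangle_free_half_feasible)
  have lower: "a \<le> card P'" if "finite P'" "\<forall>A\<in>R. A \<inter> P' \<noteq> {}" for P'
    using fractional_packing_le_piercing[OF R(1) half that] R(3) by simp
  then have card_P: "card P = a" using P by (simp add: order_antisym)
  show "piercing_number R = a"
    unfolding piercing_number_def
    by (rule Least_equality) (use P card_P lower in auto)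
  obtain x where "clique_feasible R ?E x" "(\<Sum>A\<in>R. x A) = alpha_star R"
    using clique_relaxation_attained(1)[OF R(1), of ?E] by (auto simp: alpha_star_def)
  then have "alpha_star R \<le> real a"
    using fractional_packing_le_piercing[OF R(1) _ P(1,3)] card_P by metis
  moreover have "real a \<le> alpha_star R"
    using clique_relaxation_attained(2)[OF R(1) half] R(3) by (simp add: alpha_star_def)
  ultimately show "alpha_star R = real a" by simp
qed

section \<open>Disjoint unions\<close>

lemma packing_number_attained:
  assumes "finite R"
  shows "\<exists>S\<subseteq>R. pairwise disjnt S \<and> card S = packing_number R"
    and "S \<subseteq> R \<Longrightarrow> pairwise disjnt S \<Longrightarrow> card S \<le> packing_number R"
proof -
  let ?C = "{card S | S. S \<subseteq> R \<and> pairwise disjnt S}"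
  have "?C \<subseteq> card ` Pow R" by auto
  then have fin: "finite ?C" by (rule finite_subset) (simp add: assms)
  have "0 \<in> ?C" by (auto intro!: exI[of _ "{}"])
  then have "packing_number R \<in> ?C"
    unfolding packing_number_def by (intro Max_in fin) blast
  then show "\<exists>S\<subseteq>R. pairwise disjnt S \<and> card S = packing_number R" by auto
  show "card S \<le> packing_number R" if "S \<subseteq> R" "pairwise disjnt S"
    unfolding packing_number_def by (rule Max_ge[OF fin]) (use that in auto)
qed

lemma packing_number_Un:
  assumes fin: "finite R" "finite R'" and disj: "\<And>A B. A \<in> R \<Longrightarrow> B \<in> R' \<Longrightarrow> disjnt A B"
    and RR': "R \<inter> R' = {}"
  shows "packing_number (R \<union> R') = packing_number R + packing_number R'"
proof (rule order_antisym)
  obtain S where S: "S \<subseteq> R \<union> R'" "pairwise disjnt S" "card S = packing_number (R \<union> R')"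
    using packing_number_attained(1)[of "R \<union> R'"] fin by auto
  have "S = (S \<inter> R) \<union> (S \<inter> R')" using S by blast
  then have "card S \<le> card (S \<inter> R) + card (S \<inter> R')" by (metis card_Un_le)
  also have "\<dots> \<le> packing_number R + packing_number R'"
    using fin S(2) by (intro add_mono packing_number_attained(2)) (auto intro: pairwise_subset)
  finally show "packing_number (R \<union> R') \<le> packing_number R + packing_number R'" using S by simp
next
  obtain S where S: "S \<subseteq> R" "pairwise disjnt S" "card S = packing_number R"
    using packing_number_attained(1)[of R] fin by auto
  obtain S' where S': "S' \<subseteq> R'" "pairwise disjnt S'" "card S' = packing_number R'"
    using packing_number_attained(1)[of R'] fin by auto
  have "pairwise disjnt (S \<union> S')"
    unfolding pairwise_def
  proof (intro ballI impI)
    fix A B assume "A \<in> S \<union> S'" "B \<in> S \<union> S'" "A \<noteq> B"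
    then show "disjnt A B"
      using S(1) S'(1) pairwiseD[OF S(2)] pairwiseD[OF S'(2)] disj disjnt_sym
      by (metis Un_iff subsetD)
  qed
  then have "card (S \<union> S') \<le> packing_number (R \<union> R')"
    using S S' fin by (intro packing_number_attained(2)) auto
  moreover have "card (S \<union> S') = card S + card S'"
    using S S' RR' fin by (intro card_Un_disjoint) (auto intro: finite_subset)
  ultimately show "packing_number R + packing_number R' \<le> packing_number (R \<union> R')"
    using S S' by simp
qed

lemma packing_number_image:
  assumes f: "inj f"
  shows "packing_number (image f ` R) = packing_number R"
proof -
  have pw: "pairwise disjnt (image f ` S) \<longleftrightarrow> pairwise disjnt S" for S
    using f by (simp add: pairwise_image pairwise_def disjnt_def inj_image_eq_iff image_Int[symmetric])
  have card: "card (image f ` S) = card S" for S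
    using f by (intro card_image inj_on_subset[OF inj_on_image]) (auto simp: inj_on_def inj_image_eq_iff)
  have "{card S | S. S \<subseteq> image f ` R \<and> pairwise disjnt S} = {card S | S. S \<subseteq> R \<and> pairwise disjnt S}"
    by (auto simp: subset_image_iff pw card) (metis pw card)+
  then show ?thesis by (simp add: packing_number_def)
qed

lemma axis_rectangle_translate:
  assumes "axis_rectangle A"
  shows "axis_rectangle ((+) v ` A)"
proof -
  obtain a b c d where A: "a < b" "c < d" "A = {a..b} \<times> {c..d}"
    using assms by (auto simp: axis_rectangle_def)
  have "(+) v ` A = (+) (fst v) ` {a..b} \<times> (+) (snd v) ` {c..d}"
  proof (intro set_eqI iffI)
    fix z assume "z \<in> (+) v ` A"
    then show "z \<in> (+) (fst v) ` {a..b} \<times> (+) (snd v) ` {c..d}" unfolding A by (cases v) auto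
  next
    fix z assume "z \<in> (+) (fst v) ` {a..b} \<times> (+) (snd v) ` {c..d}"
    then obtain p q where "p \<in> {a..b}" "q \<in> {c..d}" "z = v + (p, q)"
      by (auto simp: plus_prod_def simp del: image_add_atLeastAtMost)
    then show "z \<in> (+) v ` A" unfolding A by blast
  qed
  then have "(+) v ` A = {fst v + a..fst v + b} \<times> {snd v + c..snd v + d}"
    by (simp add: add.commute)
  then show ?thesis using A unfolding axis_rectangle_def by (metis add_strict_left_mono)
qed

lemma half_integral_family_translate:
  assumes "half_integral_family R a b"
  shows "half_integral_family (image ((+) v) ` R) a b"
proof -
  have inj: "inj ((+) v)" by simp
  obtain P where P: "finite P" "card P \<le> a" "\<forall>A\<in>R. A \<inter> P \<noteq> {}"
    using assms by (auto simp: half_integral_family_def)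
  have "card (image ((+) v) ` R) = card R"
    by (intro card_image) (auto simp: inj_on_def inj_image_eq_iff)
  moreover have "finite ((+) v ` P)" "card ((+) v ` P) \<le> a"
    "\<forall>A\<in>image ((+) v) ` R. A \<inter> (+) v ` P \<noteq> {}"
    using P by (auto simp: card_image)
  moreover have "triangle_free (image ((+) v) ` R)"
    using assms unfolding half_integral_family_def triangle_free_def
    by (simp add: image_Int[OF inj, symmetric] inj_image_eq_iff)
  ultimately show ?thesis
    using assms axis_rectangle_translate packing_number_image[OF inj]
    unfolding half_integral_family_def by (auto intro!: exI[of _ "(+) v ` P"])
qed

lemma half_integral_family_Un:
  assumes R: "half_integral_family R a b" and R': "half_integral_family R' a' b'"
    and disj: "\<And>A B. A \<in> R \<Longrightarrow> B \<in> R' \<Longrightarrow> A \<inter> B = {}"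
  shows "half_integral_family (R \<union> R') (a + a') (b + b')"
proof -
  obtain P where P: "finite P" "card P \<le> a" "\<forall>A\<in>R. A \<inter> P \<noteq> {}"
    using R by (auto simp: half_integral_family_def)
  obtain P' where P': "finite P'" "card P' \<le> a'" "\<forall>A\<in>R'. A \<inter> P' \<noteq> {}"
    using R' by (auto simp: half_integral_family_def)
  have RR': "R \<inter> R' = {}"
    using disj P(3) by blast
  have "card (P \<union> P') \<le> a + a'"
    using card_Un_le[of P P'] P P' by linarith
  moreover have "\<forall>A\<in>R \<union> R'. A \<inter> (P \<union> P') \<noteq> {}" using P P' by blast
  moreover have "triangle_free (R \<union> R')"
    unfolding triangle_free_def
  proof (intro ballI impI)
    fix A B C assume ABC: "A \<in> R \<union> R'" "B \<in> R \<union> R'" "C \<in> R \<union> R'"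
      "A \<noteq> B \<and> B \<noteq> C \<and> A \<noteq> C"
    have tf: "triangle_free R" "triangle_free R'"
      using R R' by (simp_all add: half_integral_family_def)
    have "A \<inter> B = {} \<or> B \<inter> C = {} \<or> A \<inter> C = {}"
      if "triangle_free T" "A \<in> T" "B \<in> T" "C \<in> T" for T
      using that ABC(4) unfolding triangle_free_def by metis
    then show "A \<inter> B = {} \<or> B \<inter> C = {} \<or> A \<inter> C = {}"
      using ABC(1-3) disj tf by (metis Int_commute Un_iff)
  qed
  moreover have "packing_number (R \<union> R') = b + b'"
    using R R' disj RR' by (subst packing_number_Un) (auto simp: half_integral_family_def disjnt_def)
  moreover have "card (R \<union> R') = 2 * (a + a')"
    using R R' RR' by (simp add: half_integral_family_def card_Un_disjoint)
  ultimately show ?thesis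
    using R R' P P' unfolding half_integral_family_def
    by (intro conjI exI[of _ "P \<union> P'"]) auto
qed

text \<open>
  Finitely many rectangles are bounded, so a horizontal translation moves one family clear of the other.
\<close>

lemma half_integral_family_sum:
  assumes R: "half_integral_family R a b" and R': "half_integral_family R' a' b'"
  shows "\<exists>R''. half_integral_family R'' (a + a') (b + b')"
proof -
  have bdd: "bounded (\<Union>R)" "bounded (\<Union>R')"
    using R R' by (auto simp: half_integral_family_def axis_rectangle_def
        intro!: bounded_Union bounded_Times)
  then obtain r where r: "r > 0" "\<And>z. z \<in> \<Union>R \<Longrightarrow> norm z < r" "\<And>z. z \<in> \<Union>R' \<Longrightarrow> norm z < r"
    using bounded_Un[of "\<Union>R" "\<Union>R'"] by (metis UnCI bounded_pos_less)
  define v :: "real \<times> real" where "v = (2 * r, 0)"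
  have "A \<inter> B = {}" if AB: "A \<in> R" "B \<in> image ((+) v) ` R'" for A B
  proof (rule ccontr)
    assume "A \<inter> B \<noteq> {}"
    then obtain z where z: "v + z \<in> \<Union>R" "z \<in> \<Union>R'" using AB by blast
    have "norm v \<le> norm (v + z) + norm z" by (metis add_diff_cancel_right' norm_triangle_ineq4)
    then show False using r(1) r(2)[OF z(1)] r(3)[OF z(2)] by (simp add: v_def)
  qed
  then show ?thesis
    using half_integral_family_Un[OF R half_integral_family_translate[OF R']] by blast
qed

section \<open>The 5-cycle of a band\<close>

text \<open>
  The five bars of a band; the boolean tells the positive side of the origin from the negative one. The bridge is the only bar
  present on both sides.
\<close>

datatype part = Outer bool | Inner bool | Bridge

fun adjacent :: "part \<Rightarrow> part \<Rightarrow> bool" where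
  "adjacent (Outer s) (Inner s') \<longleftrightarrow> s = s'"
| "adjacent (Inner s) (Outer s') \<longleftrightarrow> s = s'"
| "adjacent (Inner s) (Inner s') \<longleftrightarrow> s \<noteq> s'"
| "adjacent (Outer s) Bridge \<longleftrightarrow> True"
| "adjacent Bridge (Outer s) \<longleftrightarrow> True"
| "adjacent _ _ \<longleftrightarrow> False"

fun on_side :: "bool \<Rightarrow> part \<Rightarrow> bool" where
  "on_side s (Outer s') \<longleftrightarrow> s = s'"
| "on_side s (Inner s') \<longleftrightarrow> s = s'"
| "on_side s Bridge \<longleftrightarrow> True"

lemma UNIV_part: "UNIV = {Outer True, Outer False, Inner True, Inner False, Bridge}"
proof -
  have "p \<in> {Outer True, Outer False, Inner True, Inner False, Bridge}" for p
    by (cases p) auto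
  then show ?thesis by blast
qed

lemma finite_parts [simp]: "finite (A :: part set)"
  by (rule finite_subset[OF subset_UNIV]) (simp add: UNIV_part)

lemma card_UNIV_part: "card (UNIV :: part set) = 5"
  by (simp add: UNIV_part)

lemma adjacent_cases:
  assumes "adjacent p q"
  obtains (inner) s where "p = Inner s" "q = Inner (\<not> s)"
  | (left) s where "p = Outer s" "\<forall>s. q \<noteq> Outer s"
  | (right) s where "q = Outer s" "\<forall>s. p \<noteq> Outer s"
  using assms by (cases p; cases q) auto

lemma adjacent_no_triangle: "adjacent p q \<Longrightarrow> adjacent q r \<Longrightarrow> \<not> adjacent p r"
  by (cases p; cases q; cases r) auto

text \<open>
  This is where the ratio comes from. The 5-cycle has five vertices and independence number 2, but the bound
  also has to hold when bars on one side are blocked by crossing bars: then only one bar can be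
  chosen. Charging the bars to the sides on which the band is present covers all these cases at once.
\<close>

lemma card_parts_le_sides:
  assumes "\<And>p q. p \<in> A \<Longrightarrow> q \<in> A \<Longrightarrow> \<not> adjacent p q"
  shows "card A \<le> (\<Sum>s\<in>UNIV. of_bool (\<exists>p\<in>A. on_side s p))"
proof -
  have "card A = (\<Sum>p\<in>UNIV. of_bool (p \<in> A))"
    by (simp add: of_bool_def sum.If_cases)
  also have "\<dots> = of_bool (Outer True \<in> A) + of_bool (Outer False \<in> A) + of_bool (Inner True \<in> A)
      + of_bool (Inner False \<in> A) + of_bool (Bridge \<in> A)"
    by (simp add: UNIV_part)
  also have "\<dots> \<le> (\<Sum>s\<in>UNIV. of_bool (\<exists>p\<in>A. on_side s p))"
  proof -
    have side: "(\<exists>p\<in>A. on_side s p) \<longleftrightarrow> Outer s \<in> A \<or> Inner s \<in> A \<or> Bridge \<in> A" for s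
    proof
      assume "\<exists>p\<in>A. on_side s p"
      then obtain p where "p \<in> A" "on_side s p" by blast
      then show "Outer s \<in> A \<or> Inner s \<in> A \<or> Bridge \<in> A" by (cases p) auto
    qed (auto intro: bexI[of _ "Outer s"] bexI[of _ "Inner s"] bexI[of _ Bridge])
    have "\<not> (Outer s \<in> A \<and> Inner s \<in> A)" "\<not> (Outer s \<in> A \<and> Bridge \<in> A)"
      "\<not> (Inner True \<in> A \<and> Inner False \<in> A)" for s
      using assms[of "Outer s" "Inner s"] assms[of "Outer s" Bridge]
        assms[of "Inner True" "Inner False"] by auto
    from this(1)[of True] this(1)[of False] this(2)[of True] this(2)[of False] this(3)
    show ?thesis
      unfolding side UNIV_bool by (auto simp: of_bool_def)
  qed
  finally show ?thesis .
qed

section \<open>The bars in the plane\<close>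

text \<open>
  The spacing 5 keeps the bands of width 4 below consecutive corners disjoint.
\<close>

definition corner :: "nat \<Rightarrow> real" where
  "corner i = 5 * real i + 5"

definition signed :: "bool \<Rightarrow> real \<Rightarrow> real" where
  "signed s x = (if s then x else - x)"

definition segment :: "bool \<Rightarrow> real \<Rightarrow> real \<Rightarrow> real set" where
  "segment s a b = (if s then {a..b} else {- b..- a})"

text \<open>
  The extent of a bar in its own direction. The outer bars end at \<open>corner n\<close>, beyond all bands with index
  below \<open>n\<close>. Consecutive bars of the 5-cycle share exactly one coordinate.
\<close>

fun along :: "nat \<Rightarrow> nat \<Rightarrow> part \<Rightarrow> real set" where
  "along n i (Outer s) = segment s (corner i) (corner n)"
| "along n i (Inner s) = segment s 0 (corner i)"
| "along n i Bridge = {- corner i..corner i}"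

text \<open>
  The extent of a bar in the other direction, for the band with sign \<open>t\<close>. An outer bar fills the band, so that its
  end meets both the inner bar and the bridge, which run at different heights. Only the outer bars reach up to
  \<open>corner i\<close>; this is what lets a crossing outer bar of index \<open>i\<close> stay clear of the inner bars and
  bridges of the same index.
\<close>

fun across :: "bool \<Rightarrow> nat \<Rightarrow> part \<Rightarrow> real set" where
  "across t i (Outer s) = segment t (corner i - 4) (corner i)"
| "across t i (Inner s) = segment t (corner i - 2) (corner i - 1)"
| "across t i Bridge = segment t (corner i - 4) (corner i - 3)"

text \<open>
  An index consists of the kind (horizontal or vertical), the sign of the band, its number, and the part.
\<close>

definition bar :: "nat \<Rightarrow> bool \<times> bool \<times> nat \<times> part \<Rightarrow> (real \<times> real) set" where
  "bar n = (\<lambda>(h, t, i, p). if h then along n i p \<times> across t i p else across t i p \<times> along n i p)"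

definition indices :: "nat \<Rightarrow> (bool \<times> bool \<times> nat \<times> part) set" where
  "indices n = UNIV \<times> UNIV \<times> {..<n} \<times> UNIV"

definition family :: "nat \<Rightarrow> (real \<times> real) set set" where
  "family n = bar n ` indices n"

lemma corner_mono: "i < j \<Longrightarrow> corner i + 5 \<le> corner j"
  by (simp add: corner_def)

lemma corner_ge: "5 \<le> corner i"
  by (simp add: corner_def)

lemma across_band: "x \<in> across t i p \<Longrightarrow> corner i - 4 \<le> \<bar>x\<bar> \<and> \<bar>x\<bar> \<le> corner i \<and> (t \<longleftrightarrow> 0 < x)"
  using corner_ge[of i] by (cases p; cases t) (auto simp: segment_def)

lemma across_not_Outer: "x \<in> across t i p \<Longrightarrow> \<forall>s. p \<noteq> Outer s \<Longrightarrow> \<bar>x\<bar> \<le> corner i - 1"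
  using corner_ge[of i] by (cases p; cases t) (auto simp: segment_def)

lemma along_Outer: "x \<in> along n i (Outer s) \<Longrightarrow> corner i \<le> \<bar>x\<bar>"
  using corner_ge[of i] by (cases s) (auto simp: segment_def)

lemma along_not_Outer: "x \<in> along n i p \<Longrightarrow> \<forall>s. p \<noteq> Outer s \<Longrightarrow> \<bar>x\<bar> \<le> corner i"
  by (cases p) (auto simp: segment_def split: if_splits)

lemma band_unique:
  assumes "corner i - 4 \<le> y" "y \<le> corner i" "corner j - 4 \<le> y" "y \<le> corner j"
  shows "i = j"
  using assms corner_mono[of i j] corner_mono[of j i] by (cases i j rule: linorder_cases) auto

section \<open>No three bars meet pairwise\<close>

lemma parallel_bars_meet:
  assumes "bar n (h, t, i, p) \<inter> bar n (h, t', i', p') \<noteq> {}"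
  shows "t = t' \<and> i = i' \<and> (p = p' \<or> adjacent p p')"
proof -
  obtain x y where x: "x \<in> along n i p" "x \<in> along n i' p'"
    and y: "y \<in> across t i p" "y \<in> across t' i' p'"
    using assms by (cases h) (auto simp: bar_def)
  have ti: "t = t'" "i = i'"
    using across_band[OF y(1)] across_band[OF y(2)] band_unique[of i "\<bar>y\<bar>" i'] by auto
  have "p = p' \<or> adjacent p p'"
    using x y corner_ge[of i] unfolding ti
    by (cases p; cases p') (auto simp: segment_def split: if_splits)
  with ti show ?thesis by blast
qed

lemma adjacent_bars_meet:
  assumes "adjacent p p'" "i < n"
  shows "bar n (h, t, i, p) \<inter> bar n (h, t, i, p') \<noteq> {}"
proof -
  have "along n i p \<inter> along n i p' \<noteq> {}"
    using assms(1) corner_ge[of i] corner_mono[OF assms(2)]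
    by (cases p; cases p') (auto simp: segment_def)
  moreover have "across t i p \<inter> across t i p' \<noteq> {}"
    using assms(1) by (cases p; cases p') (auto simp: segment_def)
  ultimately show ?thesis by (auto simp: bar_def)
qed

text \<open>
  The inner bars touch at 0, where no band passes. An outer bar touches its inner bar or the bridge at
  \<open>corner i\<close>, and a crossing bar that meets both must lie in a band containing this value and reach it, so it is the outer bar
  with the same index; but that bar starts only at \<open>corner i\<close>, above the inner bar and the bridge.
\<close>

lemma crossing_misses_contact:
  assumes adj: "adjacent p p'"
    and meet: "bar n (h, t, i, p) \<inter> bar n (\<not> h, s, j, q) \<noteq> {}"
      "bar n (h, t, i, p') \<inter> bar n (\<not> h, s, j, q) \<noteq> {}"
  shows False
proof -
  obtain x y where xy: "x \<in> along n i p" "x \<in> across s j q" "y \<in> across t i p" "y \<in> along n j q"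
    using meet(1) by (cases h) (auto simp: bar_def)
  obtain x' y' where xy': "x' \<in> along n i p'" "x' \<in> across s j q" "y' \<in> across t i p'" "y' \<in> along n j q"
    using meet(2) by (cases h) (auto simp: bar_def)
  have outer_other: False
    if xy: "x \<in> along n i (Outer r)" "x \<in> across s j q"
      and xy': "x' \<in> along n i p'" "x' \<in> across s j q" "y' \<in> across t i p'" "y' \<in> along n j q"
      and p': "\<forall>s. p' \<noteq> Outer s" for x x' y' r p'
  proof -
    have x: "corner i \<le> \<bar>x\<bar>" and x': "\<bar>x'\<bar> \<le> corner i"
      using along_Outer[OF xy(1)] along_not_Outer[OF xy'(1) p'] .
    have "i = j"
      using across_band[OF xy(2)] across_band[OF xy'(2)] x x' band_unique[of i "corner i" j] by auto
    then obtain r' where "q = Outer r'"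
      using across_not_Outer[OF xy(2)] x by force
    then have "corner j \<le> \<bar>y'\<bar>" using along_Outer xy'(4) by blast
    then show False using across_not_Outer[OF xy'(3) p'] \<open>i = j\<close> by simp
  qed
  from adj show False
  proof (cases rule: adjacent_cases)
    case (inner r)
    then show False
      using across_band[OF xy(2)] across_band[OF xy'(2)] xy(1) xy'(1) corner_ge[of j]
      by (auto simp: segment_def split: if_splits)
  next
    case (left r)
    then show False using outer_other xy xy' by blast
  next
    case (right r)
    then show False using outer_other xy xy' by blast
  qed
qed

lemma triangle_free_family: "triangle_free (family n)"
proof -
  have two: False
    if "bar n (h, u) \<inter> bar n (h, v) \<noteq> {}" "bar n (h, u) \<inter> bar n (h', w) \<noteq> {}"
      "bar n (h, v) \<inter> bar n (h', w) \<noteq> {}" "u \<noteq> v" "(h', w) \<noteq> (h, u)" "(h', w) \<noteq> (h, v)"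
    for h h' u v w
  proof -
    obtain t i p where u: "u = (t, i, p)" by (cases u)
    obtain t' i' p' where v: "v = (t', i', p')" by (cases v)
    obtain s j q where w: "w = (s, j, q)" by (cases w)
    have v': "t' = t" "i' = i" "adjacent p p'"
      using parallel_bars_meet[of n h t i p t' i' p'] that(1,4) u v by auto
    show False
    proof (cases "h' = h")
      case True
      then have "adjacent p q" "adjacent p' q"
        using parallel_bars_meet[of n h t i p s j q] parallel_bars_meet[of n h t i p' s j q]
          that u v w v' by auto
      then show False using adjacent_no_triangle v'(3) by blast
    next
      case False
      then have "h' = (\<not> h)" by simp
      then show False using crossing_misses_contact[OF v'(3)] that(2,3) u v w v' by blast
    qed
  qed
  show ?thesis
    unfolding triangle_free_def family_def
  proof (intro ballI impI, elim imageE)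
    fix A B C a b c
    assume distinct: "A \<noteq> B \<and> B \<noteq> C \<and> A \<noteq> C" and abc: "A = bar n a" "B = bar n b" "C = bar n c"
    obtain h1 u h2 v h3 w where e: "a = (h1, u)" "b = (h2, v)" "c = (h3, w)"
      by (cases a; cases b; cases c)
    have ne: "a \<noteq> b" "b \<noteq> c" "a \<noteq> c" using distinct abc by auto
    have pigeon: "h1 = h2 \<or> h2 = h3 \<or> h1 = h3" by (cases h1; cases h2; cases h3) auto
    show "A \<inter> B = {} \<or> B \<inter> C = {} \<or> A \<inter> C = {}"
    proof (rule ccontr)
      assume "\<not> ?thesis"
      then have m: "bar n a \<inter> bar n b \<noteq> {}" "bar n b \<inter> bar n c \<noteq> {}" "bar n a \<inter> bar n c \<noteq> {}"
        "bar n b \<inter> bar n a \<noteq> {}" "bar n c \<inter> bar n b \<noteq> {}" "bar n c \<inter> bar n a \<noteq> {}"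
        unfolding abc by blast+
      from pigeon show False
      proof (elim disjE)
        assume "h1 = h2"
        then show False using two[of h1 u v h3 w] m ne unfolding e \<open>h1 = h2\<close> by (metis prod.inject)
      next
        assume "h2 = h3"
        then show False using two[of h2 v w h1 u] m ne unfolding e \<open>h2 = h3\<close> by (metis prod.inject)
      next
        assume "h1 = h3"
        then show False using two[of h1 u w h2 v] m ne unfolding e \<open>h1 = h3\<close> by (metis prod.inject)
      qed
    qed
  qed
qed

section \<open>Size and piercing points\<close>

lemma axis_rectangle_bar: "i < n \<Longrightarrow> axis_rectangle (bar n (h, t, i, p))"
proof -
  assume i: "i < n"
  have seg: "\<exists>c d. c < d \<and> segment s a b = {c..d}" if "a < b" for s a b
    using that by (auto simp: segment_def)
  have "\<exists>c d. c < d \<and> along n i p = {c..d}" "\<exists>c d. c < d \<and> across t i p = {c..d}"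
    using corner_mono[OF i] corner_ge[of i] by (cases p; force intro!: seg)+
  then obtain c d c' d' where "c < d" "c' < d'" "along n i p = {c..d}" "across t i p = {c'..d'}"
    by blast
  then show ?thesis unfolding axis_rectangle_def bar_def by (cases h) auto
qed

lemma inj_on_bar: "inj_on (bar n) (indices n)"
proof (rule inj_onI)
  fix a b assume ab: "a \<in> indices n" "b \<in> indices n" and eq: "bar n a = bar n b"
  obtain h t i p where a: "a = (h, t, i, p)" by (cases a)
  obtain h' t' i' p' where b: "b = (h', t', i', p')" by (cases b)
  have i: "i < n" "i' < n" using ab a b by (auto simp: indices_def)
  \<comment> \<open>Horizontal and vertical bars are told apart by their shape: bars have length at least 5 and width at most 4.\<close>
  have long: "\<exists>x\<in>along n k r. \<exists>y\<in>along n k r. x + 5 \<le> y" if "k < n" for k r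
  proof -
    have seg: "\<exists>x\<in>segment s a b. \<exists>y\<in>segment s a b. x + 5 \<le> y" if "a + 5 \<le> b" for s a b
    proof (rule bexI, rule bexI)
      show "(if s then a else - b) + 5 \<le> (if s then b else - a)" using that by simp
    qed (use that in \<open>auto simp: segment_def\<close>)
    have "\<exists>x\<in>{- corner k..corner k}. \<exists>y\<in>{- corner k..corner k}. x + 5 \<le> y"
      using seg[of "- corner k" "corner k" True] corner_ge[of k] by (simp add: segment_def)
    then show ?thesis
      using seg corner_mono[OF that] corner_ge[of k] by (cases r) simp_all
  qed
  have thin: "y \<le> x + 4" if "x \<in> across s k r" "y \<in> across s k r" for x y s k r
    using across_band[OF that(1)] across_band[OF that(2)] by (cases s) auto
  have along_ne: "along n k r \<noteq> {}" if "k < n" for k r using long[OF that, of r] by blast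
  have across_ne: "across s k r \<noteq> {}" for s k r by (cases r) (auto simp: segment_def)
  have "along n k r \<noteq> across s l q" if "k < n" for k r s l q
    using long[OF that, of r] thin[of _ s l q] by force
  then have h: "h = h'"
    using eq i along_ne across_ne unfolding a b bar_def
    by (auto simp: times_eq_iff split: if_splits)
  then have al: "along n i p = along n i' p'" and ac: "across t i p = across t' i' p'"
    using eq i along_ne across_ne unfolding a b bar_def
    by (auto simp: times_eq_iff split: if_splits)
  have "bar n (h, t, i, p) \<noteq> {}"
    using along_ne[OF i(1)] across_ne by (cases h) (simp_all add: bar_def)
  then have ti: "t = t'" "i = i'"
    using parallel_bars_meet[of n h t i p t' i' p'] eq by (simp_all add: a b h)
  have "p = p'"
    using al ac corner_ge[of i] corner_mono[OF i(1)] unfolding ti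
    by (cases p; cases p') (auto simp: segment_def Icc_eq_Icc split: if_splits)
  then show "a = b" using a b h ti by simp
qed

lemma finite_indices: "finite (indices n)" and card_indices: "card (indices n) = 20 * n"
  by (simp_all add: indices_def card_cartesian_product card_UNIV_part)

text \<open>
  A perfect matching of the intersection graph. In each of the four quadrants the two outer bars of index \<open>i\<close>
  share the corner, and the two inner bars share the point one unit inside it; the two horizontal
  bridges are matched with the vertical bridges of the same sign.
\<close>

lemma family_pierced: "\<exists>P. finite P \<and> card P \<le> 10 * n \<and> (\<forall>A\<in>family n. A \<inter> P \<noteq> {})"
proof -
  define pt where "pt i d s t = (signed s (corner i - d), signed t (corner i - d))" for i d s t
  define P where "P = (\<lambda>(i, s, t). pt i 0 s t) ` ({..<n} \<times> UNIV \<times> UNIV)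
    \<union> (\<lambda>(i, s, t). pt i 1 s t) ` ({..<n} \<times> UNIV \<times> UNIV) \<union> (\<lambda>(i, s). pt i 3 s s) ` ({..<n} \<times> UNIV)"
  have "card P \<le> 4 * n + 4 * n + 2 * n"
    unfolding P_def
    by (intro order_trans[OF card_Un_le] add_mono order_trans[OF card_image_le])
      (simp_all add: card_cartesian_product)
  moreover have "finite P" by (simp add: P_def)
  moreover have "A \<inter> P \<noteq> {}" if "A \<in> family n" for A
  proof -
    obtain h t i p where i: "i < n" and A: "A = bar n (h, t, i, p)"
      using \<open>A \<in> family n\<close> by (auto simp: family_def indices_def)
    have in_P: "pt i 0 s t' \<in> P" "pt i 1 s t' \<in> P" "pt i 3 s s \<in> P" for s t'
      unfolding P_def
      subgoal by (rule UnI1, rule UnI1, rule rev_image_eqI[of "(i, s, t')"]) (simp_all add: i)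
      subgoal by (rule UnI1, rule UnI2, rule rev_image_eqI[of "(i, s, t')"]) (simp_all add: i)
      subgoal by (rule UnI2, rule rev_image_eqI[of "(i, s)"]) (simp_all add: i)
      done
    note defs = bar_def pt_def signed_def segment_def
    show ?thesis
    proof (cases p)
      case (Outer s)
      have "pt i 0 (if h then s else t) (if h then t else s) \<in> A"
        using corner_mono[OF i] unfolding A Outer by (auto simp: defs)
      then show ?thesis using in_P by blast
    next
      case (Inner s)
      have "pt i 1 (if h then s else t) (if h then t else s) \<in> A"
        using corner_ge[of i] unfolding A Inner by (auto simp: defs)
      then show ?thesis using in_P by blast
    next
      case Bridge
      have "pt i 3 t t \<in> A"
        using corner_ge[of i] unfolding A Bridge by (auto simp: defs)
      then show ?thesis using in_P by blast
    qed
  qed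
  ultimately show ?thesis by (intro exI[of _ P]) simp
qed

section \<open>Disjoint bars\<close>

lemma crossing_bars_meet:
  assumes "on_side s p" "on_side t q" "i < n" "(\<exists>r. p = Outer r) \<longleftrightarrow> (\<exists>r. q = Outer r)"
  shows "bar n (True, t, i, p) \<inter> bar n (False, s, i, q) \<noteq> {}"
proof -
  have "along n i p \<inter> across s i q \<noteq> {}"
    using assms corner_ge[of i] corner_mono[OF assms(3)]
    by (cases p; cases q) (auto simp: segment_def)
  moreover have "along n i q \<inter> across t i p \<noteq> {}"
    using assms corner_ge[of i] corner_mono[OF assms(3)]
    by (cases p; cases q) (auto simp: segment_def)
  ultimately show ?thesis by (auto simp: bar_def)
qed

text \<open>
  An outer bar is disjoint from the inner bars and bridges of the other kind with its own index, so these are the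
  pairs that can be chosen together; they conflict with each other across different indices.
\<close>

lemma outer_crosses_later_inner:
  assumes "i < j" "j < n" "on_side t q" "\<forall>r. q \<noteq> Outer r"
  shows "bar n (h, t, i, Outer s) \<inter> bar n (\<not> h, s, j, q) \<noteq> {}"
proof -
  have "along n i (Outer s) \<inter> across s j q \<noteq> {}"
    using assms corner_mono[OF assms(1)] corner_mono[OF assms(2)]
    by (cases q) (auto simp: segment_def)
  moreover have "along n j q \<inter> across t i (Outer s) \<noteq> {}"
    using assms corner_ge[of i] corner_mono[OF assms(1)]
    by (cases q) (auto simp: segment_def)
  ultimately show ?thesis by (auto simp: bar_def)
qed

text \<open>
  Summing the 5-cycle bound over all bands counts, for each quadrant, the indices \<open>H\<close> for which the horizontal
  band is present in the quadrant and the indices \<open>V\<close> for which the vertical band is. They overlap only in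
  indices of the two exceptional sets \<open>X\<close>, which have at most one element each.
\<close>

lemma card_disjoint_bars:
  assumes N: "N \<subseteq> indices n"
    and disj: "\<And>a b. a \<in> N \<Longrightarrow> b \<in> N \<Longrightarrow> a \<noteq> b \<Longrightarrow> bar n a \<inter> bar n b = {}"
  shows "card N \<le> 4 * n + 8"
proof -
  define parts where "parts h t i = {p. (h, t, i, p) \<in> N}" for h t i
  define H where "H s t = {i\<in>{..<n}. \<exists>p\<in>parts True t i. on_side s p}" for s t
  define V where "V s t = {i\<in>{..<n}. \<exists>q\<in>parts False s i. on_side t q}" for s t
  have quadrant: "card (H s t) + card (V s t) \<le> n + 2" for s t
  proof -
    define X where "X h s t = {i\<in>{..<n}. Outer s \<in> parts h t i \<and>
        (\<exists>q\<in>parts (\<not> h) s i. on_side t q \<and> (\<forall>r. q \<noteq> Outer r))}" for h s t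
    have X: "card (X h s t) \<le> 1" for h s t
    proof -
      have "\<not> i < j" if ij: "i \<in> X h s t" "j \<in> X h s t" for i j
      proof
        assume "i < j"
        obtain q where q: "(h, t, i, Outer s) \<in> N" "(\<not> h, s, j, q) \<in> N" "j < n" "on_side t q"
          "\<forall>r. q \<noteq> Outer r"
          using ij by (auto simp: X_def parts_def)
        then show False
          using outer_crosses_later_inner[OF \<open>i < j\<close>] disj[OF q(1,2)] by force
      qed
      then have "\<forall>i\<in>X h s t. \<forall>j\<in>X h s t. i = j" by (metis linorder_neqE_nat)
      moreover have "finite (X h s t)" by (simp add: X_def)
      ultimately show ?thesis by (simp add: card_le_Suc0_iff_eq)
    qed
    have "H s t \<inter> V s t \<subseteq> X True s t \<union> X False t s"
    proof
      fix i assume "i \<in> H s t \<inter> V s t"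
      then obtain p q where i: "i < n" and p: "p \<in> parts True t i" "on_side s p"
        and q: "q \<in> parts False s i" "on_side t q"
        by (auto simp: H_def V_def)
      have "bar n (True, t, i, p) \<inter> bar n (False, s, i, q) = {}"
        using p q by (intro disj) (auto simp: parts_def)
      then have ne: "(\<exists>r. p = Outer r) \<noteq> (\<exists>r. q = Outer r)"
        using crossing_bars_meet[OF p(2) q(2) i] by blast
      show "i \<in> X True s t \<union> X False t s"
      proof (cases "\<exists>r. p = Outer r")
        case True
        then have "p = Outer s" "\<forall>r. q \<noteq> Outer r" using p(2) ne by auto
        then have "i \<in> X True s t" using i p q unfolding X_def by auto
        then show ?thesis ..
      next
        case False
        then have "q = Outer t" "\<forall>r. p \<noteq> Outer r" using q(2) ne by auto
        then have "i \<in> X False t s" using i p q unfolding X_def by auto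
        then show ?thesis ..
      qed
    qed
    then have "card (H s t \<inter> V s t) \<le> card (X True s t \<union> X False t s)"
      by (rule card_mono[rotated]) (simp add: X_def)
    also have "\<dots> \<le> 2"
      using card_Un_le[of "X True s t" "X False t s"] X[of True s t] X[of False t s] by linarith
    finally have "card (H s t \<inter> V s t) \<le> 2" .
    moreover have "card (H s t \<union> V s t) \<le> n"
      using card_mono[of "{..<n}" "H s t \<union> V s t"] by (auto simp: H_def V_def)
    moreover have "card (H s t) + card (V s t) = card (H s t \<union> V s t) + card (H s t \<inter> V s t)"
      by (intro card_Un_Int) (auto simp: H_def V_def)
    ultimately show ?thesis by linarith
  qed
  define w where "w h t i s = (of_bool (\<exists>p\<in>parts h t i. on_side s p) :: nat)" for h t i s
  have band: "card (parts h t i) \<le> (\<Sum>s\<in>UNIV. w h t i s)" if "i < n" for h t i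
    unfolding w_def
  proof (rule card_parts_le_sides)
    fix p q assume pq: "p \<in> parts h t i" "q \<in> parts h t i"
    show "\<not> adjacent p q"
    proof
      assume adj: "adjacent p q"
      then have "p \<noteq> q" by (cases p) auto
      then show False
        using adjacent_bars_meet[OF adj that, of h t] disj pq by (auto simp: parts_def)
    qed
  qed
  have "N = Sigma UNIV (\<lambda>h. Sigma UNIV (\<lambda>t. Sigma {..<n} (parts h t)))"
    using N by (auto simp: parts_def indices_def)
  then have "card N = card (Sigma UNIV (\<lambda>h. Sigma UNIV (\<lambda>t. Sigma {..<n} (parts h t))))"
    by simp
  also have "\<dots> = (\<Sum>h\<in>UNIV. \<Sum>t\<in>UNIV. \<Sum>i<n. card (parts h t i))"
    by (simp add: card_SigmaI)
  also have "\<dots> \<le> (\<Sum>h\<in>UNIV. \<Sum>t\<in>UNIV. \<Sum>i<n. \<Sum>s\<in>UNIV. w h t i s)"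
    by (intro sum_mono band) simp
  also have "\<dots> = (\<Sum>s\<in>UNIV. \<Sum>t\<in>UNIV. card (H s t) + card (V s t))"
  proof -
    have "card (H s t) = (\<Sum>i<n. w True t i s)" "card (V s t) = (\<Sum>i<n. w False s i t)" for s t
      by (simp_all add: H_def V_def w_def of_bool_def sum.If_cases Int_def)
    then show ?thesis by (simp add: UNIV_bool sum.distrib)
  qed
  also have "\<dots> \<le> (\<Sum>s\<in>(UNIV::bool set). \<Sum>t\<in>(UNIV::bool set). n + 2)"
    by (intro sum_mono quadrant)
  finally show ?thesis by simp
qed

lemma packing_number_family: "packing_number (family n) \<le> 4 * n + 8"
proof -
  have "finite (family n)" by (simp add: family_def finite_indices)
  from packing_number_attained(1)[OF this]
  obtain S where S: "S \<subseteq> family n" "pairwise disjnt S" "card S = packing_number (family n)" by blast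
  obtain N where N: "N \<subseteq> indices n" "S = bar n ` N"
    using S(1) unfolding family_def by (meson subset_imageE)
  have inj: "inj_on (bar n) N" using inj_on_bar N(1) by (rule inj_on_subset)
  have "bar n a \<inter> bar n b = {}" if "a \<in> N" "b \<in> N" "a \<noteq> b" for a b
  proof -
    have "bar n a \<noteq> bar n b" using inj_onD[OF inj] that by blast
    then have "disjnt (bar n a) (bar n b)"
      using S(2) N(2) that by (intro pairwiseD[OF S(2)]) auto
    then show ?thesis by (simp add: disjnt_def)
  qed
  from card_disjoint_bars[OF N(1) this] show ?thesis
    using S(3) N(2) card_image[OF inj] by simp
qed

lemma half_integral_family_bars: "\<exists>b\<le>4 * n + 8. half_integral_family (family n) (10 * n) b"
proof (intro exI conjI)
  show "half_integral_family (family n) (10 * n) (packing_number (family n))"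
    unfolding half_integral_family_def
  proof (intro conjI)
    show "\<forall>A\<in>family n. axis_rectangle A"
      by (auto simp: family_def indices_def intro: axis_rectangle_bar)
    show "card (family n) = 2 * (10 * n)"
      by (simp add: family_def card_image[OF inj_on_bar] card_indices)
    show "finite (family n)" by (simp add: family_def finite_indices)
  qed (rule triangle_free_family family_pierced refl)+
qed (rule packing_number_family)

section \<open>Attaining every ratio\<close>

lemma half_integral_family_pair: "\<exists>R. half_integral_family R 1 1"
proof -
  define A B :: "(real \<times> real) set" where "A = {0..1} \<times> {0..1}" and "B = {0..2} \<times> {0..1}"
  have AB: "(2, 0) \<in> B" "(2, 0) \<notin> A" "(0, 0) \<in> A" "(0, 0) \<in> B" by (simp_all add: A_def B_def)
  then have ne: "A \<noteq> B" by metis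
  have "axis_rectangle A"
    unfolding axis_rectangle_def A_def
    by (rule exI[of _ 0], rule exI[of _ 1], rule exI[of _ 0], rule exI[of _ 1]) simp
  moreover have "axis_rectangle B"
    unfolding axis_rectangle_def B_def
    by (rule exI[of _ 0], rule exI[of _ 2], rule exI[of _ 0], rule exI[of _ 1]) simp
  moreover have "triangle_free {A, B}" by (auto simp: triangle_free_def)
  moreover have "\<forall>C\<in>{A, B}. C \<inter> {(0, 0)} \<noteq> {}" using AB by auto
  moreover have "packing_number {A, B} = 1"
  proof (rule order_antisym)
    obtain S where S: "S \<subseteq> {A, B}" "pairwise disjnt S" "card S = packing_number {A, B}"
      using packing_number_attained(1)[of "{A, B}"] by auto
    have "\<not> disjnt A B" using AB(3,4) by (auto simp: disjnt_def)
    then have "S \<noteq> {A, B}" using S(2) ne by (auto simp: pairwise_insert)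
    then have "S \<subset> {A, B}" using S(1) by blast
    then have "card S < card {A, B}" by (rule psubset_card_mono[rotated]) simp
    then show "packing_number {A, B} \<le> 1" using S(3) ne by simp
    have "card {A} \<le> packing_number {A, B}" by (rule packing_number_attained(2)) auto
    then show "1 \<le> packing_number {A, B}" by simp
  qed
  ultimately have "half_integral_family {A, B} 1 1"
    unfolding half_integral_family_def using ne by (intro conjI exI[of _ "{(0, 0)}"]) auto
  then show ?thesis ..
qed

lemma half_integral_family_multiple:
  assumes "half_integral_family R a b" and "0 < m"
  shows "\<exists>R'. half_integral_family R' (m * a) (m * b)"
  using assms(2)
proof (induction m rule: nat_induct_non_zero)
  case 1
  then show ?case using assms(1) by auto
next
  case (Suc m)
  then show ?case using half_integral_family_sum[OF assms(1)] by fastforce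
qed

text \<open>
  For \<open>t = p / q\<close>, a family with parameters \<open>(10n, b)\<close> and \<open>s\<close> additional pairs have ratio \<open>t\<close> if
  \<open>s (p - q) = 10nq - pb\<close>. Taking \<open>p - q\<close> copies of the family multiplies the right-hand side by
  \<open>p - q\<close>, so that \<open>s = 10nq - pb\<close> is a solution.
\<close>

lemma half_integral_family_ratio:
  assumes "t \<in> \<rat>" "1 \<le> t" "t < 5 / 2"
  shows "\<exists>R a b. half_integral_family R a b \<and> 0 < a \<and> 0 < b \<and> real a / real b = t"
proof -
  obtain p q :: nat where q: "q \<noteq> 0" and t: "t = real p / real q"
    using Rats_abs_nat_div_natE[OF assms(1)] assms(2) by (metis abs_of_nonneg order_trans zero_le_one)
  have "real q \<le> real p" "2 * real p < 5 * real q"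
    using assms(2,3) q unfolding t by (simp_all add: field_simps)
  then have pq: "q \<le> p" "2 * p < 5 * q" by linarith+
  obtain R1 where R1: "half_integral_family R1 1 1" using half_integral_family_pair by blast
  show ?thesis
  proof (cases "p = q")
    case True
    then show ?thesis using R1 q t by (intro exI[of _ R1] exI[of _ 1]) simp
  next
    case False
    \<comment> \<open>Since \<open>10q - 4p \<ge> 2\<close>, the inequality \<open>p (4n + 8) < 10qn\<close> holds as soon as \<open>4p < n\<close>.\<close>
    define n where "n = 4 * p + 1"
    obtain b where b: "b \<le> 4 * n + 8" "half_integral_family (family n) (10 * n) b"
      using half_integral_family_bars by blast
    have "p * b \<le> p * (4 * n + 8)" using b(1) by (rule mult_le_mono2)
    also have "\<dots> = 4 * p * n + 8 * p" by (simp add: algebra_simps)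
    also have "\<dots> < 4 * p * n + 2 * n" by (simp add: n_def)
    also have "\<dots> = (4 * p + 2) * n" by (simp add: algebra_simps)
    also have "\<dots> \<le> 10 * q * n" using pq by (intro mult_le_mono1) simp
    finally have less: "p * b < 10 * q * n" .
    define s where "s = 10 * q * n - p * b"
    define m where "m = p - q"
    have s: "0 < s" "s + p * b = 10 * q * n" and m: "0 < m" "p = q + m"
      using less pq False by (simp_all add: s_def m_def)
    obtain R2 where R2: "half_integral_family R2 (m * (10 * n)) (m * b)"
      using half_integral_family_multiple[OF b(2) m(1)] by blast
    obtain R3 where R3: "half_integral_family R3 (s * 1) (s * 1)"
      using half_integral_family_multiple[OF R1 s(1)] by blast
    obtain R where R: "half_integral_family R (m * (10 * n) + s * 1) (m * b + s * 1)"
      using half_integral_family_sum[OF R2 R3] by blast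
    have "q * (m * (10 * n) + s) = m * (10 * q * n) + q * s" by (simp add: algebra_simps)
    also have "\<dots> = m * (s + p * b) + q * s" by (simp only: s(2))
    also have "\<dots> = (q + m) * s + p * (m * b)" by (simp add: algebra_simps)
    also have "\<dots> = p * (m * b + s)" unfolding m(2)[symmetric] by (simp add: algebra_simps)
    finally have "real q * real (m * (10 * n) + s) = real p * real (m * b + s)"
      by (metis of_nat_mult)
    then have eq: "real (m * (10 * n) + s) * real q = real p * real (m * b + s)"
      by (simp only: mult.commute)
    have nz: "real (m * b + s) \<noteq> 0" "real q \<noteq> 0" using q s(1) by (simp_all only: of_nat_eq_0_iff) auto
    have "real (m * (10 * n) + s) / real (m * b + s) = t"
      unfolding t frac_eq_eq[OF nz] by (rule eq)
    with R s(1) show ?thesis by (metis add_gr_0 mult.right_neutral)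
  qed
qed

theorem theorem4:
  shows "(\<forall>t::real. t \<in> \<rat> \<and> 1 \<le> t \<and> t < 5 / 2 \<longrightarrow>
            (\<exists>R :: (real \<times> real) set set.
               finite R \<and> R \<noteq> {} \<and> (\<forall>A\<in>R. axis_rectangle A) \<and>
               alpha_star R / real (packing_number R) = t))
       \<and> (\<forall>t::real. t \<in> \<rat> \<and> 1 \<le> t \<and> t < 5 / 2 \<longrightarrow>
            (\<exists>R :: (real \<times> real) set set.
               finite R \<and> R \<noteq> {} \<and> (\<forall>A\<in>R. axis_rectangle A) \<and>
               real (piercing_number R) / real (packing_number R) = t))"
proof -
  have family: "\<exists>R :: (real \<times> real) set set. finite R \<and> R \<noteq> {} \<and> (\<forall>A\<in>R. axis_rectangle A) \<and>
      alpha_star R / real (packing_number R) = t \<and> real (piercing_number R) / real (packing_number R) = t"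
    if t: "t \<in> \<rat> \<and> 1 \<le> t \<and> t < 5 / 2" for t :: real
  proof -
    obtain R a b where R: "half_integral_family R a b" and ab: "0 < a" "real a / real b = t"
      using half_integral_family_ratio t by blast
    have "R \<noteq> {}" using R ab(1) by (auto simp: half_integral_family_def)
    then show ?thesis
      using R ab(2) half_integral_family_values[OF R]
      by (intro exI[of _ R]) (simp add: half_integral_family_def)
  qed
  show ?thesis by (intro conjI allI impI; drule family; blast)
qed

end
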